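(* Let $X$ be a tree. Then $NC^*(X)$ is connected if and only if $X$ is homeomorphic to the interval $[0,1]$.
   Context: A continuum is a compact connected metric space with more than one point; a subcontinuum of $X$ is a nonempty closed connected subset of $X$ (one-point sets are allowed). An arc is a space homeomorphic to $[0,1]$. A finite graph is a continuum that can be written as the union of finitely many arcs, any two of which can intersect in at most one or both of their end points. A tree is a finite graph containing no simple closed curve. $C(X)$ is the set of all subcontinua of $X$, endowed with the Hausdorff metric (equivalently, the Vietoris topology), and $NC^*(X)=\{A\in C(X): X\setminus A \text{ is connected}\}$ with the subspace topology; the empty set counts as connected, so $X\in NC^*(X)$. *)

theory Defs
  imports "HOL-Analysis.Analysis"
begin

text \<open>Continua are represented as subsets of an ambient metric space (any metric space is such
  a subset, with the ambient space as itself); all notions below depend only on the induced metric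
  of the subset.\<close>

definition continuum :: "'a::metric_space set \<Rightarrow> bool" where
  "continuum X \<longleftrightarrow> compact X \<and> connected X \<and> (\<exists>x\<in>X. \<exists>y\<in>X. x \<noteq> y)"

text \<open>Arcs are given by injective parametrisations on the unit interval, which are homeomorphisms
  onto their images by compactness; the parametrisation provides the end points.\<close>

definition finite_graph :: "'a::metric_space set \<Rightarrow> bool" where
  "finite_graph X \<longleftrightarrow> continuum X \<and>
     (\<exists>G. finite G \<and> (\<forall>g\<in>G. arc g) \<and> X = (\<Union>g\<in>G. path_image g) \<and>
        (\<forall>g\<in>G. \<forall>h\<in>G. g \<noteq> h \<longrightarrow>
           path_image g \<inter> path_image h
             \<subseteq> {pathstart g, pathfinish g} \<inter> {pathstart h, pathfinish h}))"

definition simple_closed_curve :: "'a::metric_space set \<Rightarrow> bool" where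
  "simple_closed_curve S \<longleftrightarrow> S homeomorphic sphere (0::complex) 1"

definition tree :: "'a::metric_space set \<Rightarrow> bool" where
  "tree X \<longleftrightarrow> finite_graph X \<and> \<not> (\<exists>S\<subseteq>X. simple_closed_curve S)"

definition subcontinua :: "'a::metric_space set \<Rightarrow> 'a set set" where
  "subcontinua X = {A. A \<noteq> {} \<and> closedin (top_of_set X) A \<and> connected A}"

text \<open>The guard only totalises the Hausdorff distance: on nonempty bounded sets both suprema
  range over nonempty sets that are bounded above.\<close>

definition hausdorff_dist :: "'a::metric_space set \<Rightarrow> 'a set \<Rightarrow> real" where
  "hausdorff_dist A B =
     (if A = {} \<or> B = {} \<or> \<not> bounded A \<or> \<not> bounded B then 0
      else max (SUP a\<in>A. infdist a B) (SUP b\<in>B. infdist b A))"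

definition hyperspace :: "'a::metric_space set \<Rightarrow> 'a set topology" where
  "hyperspace X = Metric_space.mtopology (subcontinua X) hausdorff_dist"

definition NC_star :: "'a::metric_space set \<Rightarrow> 'a set set" where
  "NC_star X = {A \<in> subcontinua X. connected (X - A)}"

lemma bdd_above_infdist:
  assumes "bounded A" "B \<noteq> {}"
  shows "bdd_above ((\<lambda>a. infdist a B) ` A)"
proof -
  obtain b where b: "b \<in> B" using assms by blast
  obtain e where e: "\<forall>a\<in>A. dist b a \<le> e" using assms(1) bounded_any_center by blast
  have "infdist a B \<le> e" if "a \<in> A" for a
    using infdist_le[OF b, of a] e that by (force simp: dist_commute)
  then show ?thesis by (auto simp: bdd_above_def)
qed

lemma hausdorff_dist_le_iff:
  assumes "A \<noteq> {}" "B \<noteq> {}" "bounded A" "bounded B"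
  shows "hausdorff_dist A B \<le> e \<longleftrightarrow> (\<forall>a\<in>A. infdist a B \<le> e) \<and> (\<forall>b\<in>B. infdist b A \<le> e)"
  using assms by (simp add: hausdorff_dist_def cSUP_le_iff bdd_above_infdist)

lemma infdist_triangle_sets:
  assumes "B \<noteq> {}" "\<forall>b\<in>B. infdist b C \<le> e"
  shows "infdist a C \<le> infdist a B + e"
proof -
  have "infdist a C - e \<le> dist a b" if "b \<in> B" for b
    using infdist_triangle[of a C b] assms(2) that by force
  then have "infdist a C - e \<le> infdist a B"
    using assms(1) by (simp add: infdist_notempty cINF_greatest)
  then show ?thesis by simp
qed

lemma Metric_space_subcontinua:
  assumes "compact X"
  shows "Metric_space (subcontinua X) hausdorff_dist"
proof
  have sub: "A \<noteq> {} \<and> bounded A \<and> closed A" if "A \<in> subcontinua X" for A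
    using that assms closedin_compact compact_imp_bounded compact_imp_closed
    unfolding subcontinua_def by blast
  show nonneg: "0 \<le> hausdorff_dist A B" for A B :: "'a set"
  proof (cases "A = {} \<or> B = {} \<or> \<not> bounded A \<or> \<not> bounded B")
    case False
    then obtain a where "a \<in> A" by blast
    then have "infdist a B \<le> hausdorff_dist A B"
      using False hausdorff_dist_le_iff[of A B "hausdorff_dist A B"] by blast
    then show ?thesis using infdist_nonneg[of a B] by linarith
  qed (simp add: hausdorff_dist_def)
  show "hausdorff_dist A B = hausdorff_dist B A" for A B :: "'a set"
    by (auto simp: hausdorff_dist_def max.commute)
  show "hausdorff_dist A B = 0 \<longleftrightarrow> A = B"
    if "A \<in> subcontinua X" "B \<in> subcontinua X" for A B
  proof -
    have "hausdorff_dist A B = 0 \<longleftrightarrow> hausdorff_dist A B \<le> 0"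
      using nonneg[of A B] by linarith
    also have "\<dots> \<longleftrightarrow> (\<forall>a\<in>A. infdist a B \<le> 0) \<and> (\<forall>b\<in>B. infdist b A \<le> 0)"
      using sub that by (intro hausdorff_dist_le_iff) auto
    also have "\<dots> \<longleftrightarrow> (\<forall>a\<in>A. a \<in> B) \<and> (\<forall>b\<in>B. b \<in> A)"
      using sub[OF that(1)] sub[OF that(2)] in_closed_iff_infdist_zero
      by (metis infdist_nonneg order_antisym order_refl)
    finally show ?thesis by blast
  qed
  show "hausdorff_dist A C \<le> hausdorff_dist A B + hausdorff_dist B C"
    if "A \<in> subcontinua X" "B \<in> subcontinua X" "C \<in> subcontinua X" for A B C
  proof -
    note s = sub[OF that(1)] sub[OF that(2)] sub[OF that(3)]
    let ?e = "hausdorff_dist A B" and ?f = "hausdorff_dist B C"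
    have AB: "(\<forall>a\<in>A. infdist a B \<le> ?e) \<and> (\<forall>b\<in>B. infdist b A \<le> ?e)"
      using hausdorff_dist_le_iff[of A B ?e] s by blast
    have BC: "(\<forall>b\<in>B. infdist b C \<le> ?f) \<and> (\<forall>c\<in>C. infdist c B \<le> ?f)"
      using hausdorff_dist_le_iff[of B C ?f] s by blast
    have "infdist a C \<le> ?e + ?f" if "a \<in> A" for a
      using infdist_triangle_sets[of B C ?f a] AB BC s that by force
    moreover have "infdist c A \<le> ?e + ?f" if "c \<in> C" for c
      using infdist_triangle_sets[of B A ?e c] AB BC s that by force
    ultimately show ?thesis
      using hausdorff_dist_le_iff[of A C "?e + ?f"] s by blast
  qed
qed

lemma topspace_hyperspace:
  "compact X \<Longrightarrow> topspace (hyperspace X) = subcontinua X"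
  by (simp add: hyperspace_def Metric_space.topspace_mtopology Metric_space_subcontinua)

end

theory Submission
  imports Defs
begin

text \<open>An arc with parametrisation \<open>h\<close> has only the subcontinua \<open>h ` {a..b}\<close>, and such a set has
  connected complement exactly when \<open>a = 0\<close> or \<open>b = 1\<close>. Hence \<open>NC_star\<close> is the continuous image
  of two adjacent sides of a triangle, a connected set: this is \<open>NC_star_arc\<close>, \<open>connected_NC_star_arc\<close>.

  A tree that is not an arc has a branch point \<open>w\<close>, at which at least three closed pieces
  \<open>P\<close>, \<open>Q\<close>, \<open>R\<close> of the tree meet, pairwise in \<open>w\<close> only. A member \<open>B\<close> of \<open>NC_star\<close> contained in \<open>P\<close>
  cannot contain \<open>w\<close>, since its complement would then be split into its parts in \<open>P \<union> Q\<close> and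
  in \<open>R\<close>. So among the members of \<open>NC_star\<close>, being contained in the closed set \<open>P\<close> is the same
  as missing the closed set \<open>Q \<union> R\<close>. The first condition is closed and the second is open, and
  the members satisfying them form a clopen family. It omits the whole tree, and it is not empty as
  \<open>P - {w}\<close> contains an end point of the tree, whose singleton is a member of the family
  (\<open>ramified_imp_NC_star_not_connected\<close>).

  That a tree is an arc or branches in this way follows by building it up arc by arc
  (\<open>tree_arc_or_ramified\<close>). By connectedness there is always another arc that touches the part
  built so far. If it touched the part at both of its end points, it would close up to a simple
  closed curve, because the part is arcwise connected; so it is attached at a single end point.
  Attached to an arc it gives a longer arc or creates a branch point, and attached to a space
  with a branch point it leaves that branch point in place.\<close>

section \<open>Closeness in the Hausdorff metric\<close>

lemma infdist_less_obtains:
  assumes "infdist x A < e" "A \<noteq> {}"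
  obtains a where "a \<in> A" "dist x a < e"
proof -
  have "(INF a\<in>A. dist x a) < e"
    using assms by (simp add: infdist_notempty)
  then show ?thesis
    using that assms(2) by (auto simp: cINF_less_iff)
qed

lemma subcontinua_compact:
  assumes "compact X" "A \<in> subcontinua X"
  shows "A \<noteq> {}" "compact A" "connected A" "A \<subseteq> X" "bounded A"
  using assms closedin_compact[of X A] compact_imp_bounded[of A] closedin_imp_subset
  by (auto simp: subcontinua_def)

lemma subcontinuaI:
  assumes "closed A" "connected A" "A \<noteq> {}" "A \<subseteq> X"
  shows "A \<in> subcontinua X"
  using assms by (simp add: subcontinua_def closed_subset)

lemma hausdorff_dist_less_obtains:
  assumes "compact X" "A \<in> subcontinua X" "B \<in> subcontinua X"
    and "hausdorff_dist A B < e" "a \<in> A"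
  obtains b where "b \<in> B" "dist a b < e"
proof -
  have "infdist a B \<le> hausdorff_dist A B"
    using hausdorff_dist_le_iff[of A B "hausdorff_dist A B"] assms
      subcontinua_compact[of X A] subcontinua_compact[of X B] by blast
  then show ?thesis
    using infdist_less_obtains[of a B e] that assms subcontinua_compact(1)[of X B] by force
qed

text \<open>The next two lemmas are the two halves of the Vietoris topology: being contained in an open
  set, and meeting an open set, are both open conditions.\<close>

lemma openin_hyperspace_disjoint_closed:
  assumes X: "compact X" and F: "closed F" "F \<noteq> {}"
  shows "openin (hyperspace X) {A \<in> subcontinua X. A \<inter> F = {}}"
proof -
  interpret Metric_space "subcontinua X" hausdorff_dist
    using X by (rule Metric_space_subcontinua)
  have "\<exists>r>0. mball A r \<subseteq> {A \<in> subcontinua X. A \<inter> F = {}}"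
    if A: "A \<in> subcontinua X" "A \<inter> F = {}" for A
  proof -
    note sA = subcontinua_compact[OF X A(1)]
    obtain a0 where a0: "a0 \<in> A" "\<forall>a\<in>A. infdist a0 F \<le> infdist a F"
      using continuous_attains_inf[OF sA(2,1) continuous_on_infdist[OF continuous_on_id]] by blast
    have pos: "infdist a0 F > 0"
      using a0(1) A(2) F by (metis disjoint_iff infdist_pos_not_in_closed)
    have "B \<inter> F = {}" if B: "B \<in> subcontinua X" "hausdorff_dist A B < infdist a0 F" for B
    proof (rule ccontr)
      assume "B \<inter> F \<noteq> {}"
      then obtain b where b: "b \<in> B" "b \<in> F" by blast
      have "hausdorff_dist B A < infdist a0 F"
        using B(2) by (simp add: commute)
      then obtain a where a: "a \<in> A" "dist b a < infdist a0 F"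
        using hausdorff_dist_less_obtains[OF X B(1) A(1) _ b(1)] by blast
      then show False
        using a0(2) infdist_le[OF b(2), of a] by (force simp: dist_commute)
    qed
    then have "mball A (infdist a0 F) \<subseteq> {A \<in> subcontinua X. A \<inter> F = {}}"
      unfolding mball_def by blast
    then show ?thesis
      using pos by blast
  qed
  then show ?thesis
    by (auto simp: hyperspace_def openin_mtopology)
qed

lemma openin_hyperspace_not_subset_closed:
  assumes X: "compact X" and P: "closed P"
  shows "openin (hyperspace X) {A \<in> subcontinua X. \<not> A \<subseteq> P}"
proof -
  interpret Metric_space "subcontinua X" hausdorff_dist
    using X by (rule Metric_space_subcontinua)
  have "\<exists>r>0. mball A r \<subseteq> {A \<in> subcontinua X. \<not> A \<subseteq> P}"
    if A: "A \<in> subcontinua X" "\<not> A \<subseteq> P" for A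
  proof -
    obtain a where a: "a \<in> A" "a \<notin> P"
      using A(2) by blast
    obtain e where e: "e > 0" "ball a e \<subseteq> - P"
      using P a(2) by (meson ComplI open_Compl open_contains_ball)
    have "\<not> B \<subseteq> P" if B: "B \<in> subcontinua X" "hausdorff_dist A B < e" for B
    proof -
      obtain b where "b \<in> B" "dist a b < e"
        using hausdorff_dist_less_obtains[OF X A(1) B a(1)] by blast
      then show ?thesis
        using e(2) by (auto simp: subset_iff)
    qed
    then show ?thesis
      using e(1) by (intro exI[of _ e]) (auto simp: in_mball)
  qed
  then show ?thesis
    by (auto simp: hyperspace_def openin_mtopology)
qed

section \<open>Ramified spaces\<close>

text \<open>The point \<open>w\<close> is a branch point of order at least three: \<open>P\<close>, \<open>Q\<close>, \<open>R\<close> each group together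
  some of the branches at \<open>w\<close>. In a tree \<open>A\<close> could be chosen to be an end point of the tree lying
  in \<open>P\<close>. Allowing any subcontinuum makes the condition stable under attaching further pieces, even
  at that end point: \<open>A\<close> then simply absorbs the new piece.\<close>

definition ramified :: "'a::topological_space set \<Rightarrow> bool" where
  "ramified Y \<longleftrightarrow> (\<exists>w P Q R A. Y = P \<union> Q \<union> R \<and> closed P \<and> closed Q \<and> closed R \<and>
     P \<inter> Q = {w} \<and> P \<inter> R = {w} \<and> Q \<inter> R = {w} \<and> Q \<noteq> {w} \<and> R \<noteq> {w} \<and>
     closed A \<and> connected A \<and> A \<noteq> {} \<and> A \<subseteq> P - {w} \<and> connected (Y - A))"

lemma ramifiedI:
  assumes "Y = P \<union> Q \<union> R" "closed P" "closed Q" "closed R"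
    "P \<inter> Q = {w}" "P \<inter> R = {w}" "Q \<inter> R = {w}" "Q \<noteq> {w}" "R \<noteq> {w}"
    "closed A" "connected A" "A \<noteq> {}" "A \<subseteq> P - {w}" "connected (Y - A)"
  shows "ramified Y"
  unfolding ramified_def using assms by (intro exI conjI) assumption+

lemma ramifiedE:
  assumes "ramified Y"
  obtains w P Q R A where "Y = P \<union> Q \<union> R" "closed P" "closed Q" "closed R"
    "P \<inter> Q = {w}" "P \<inter> R = {w}" "Q \<inter> R = {w}" "Q \<noteq> {w}" "R \<noteq> {w}"
    "closed A" "connected A" "A \<noteq> {}" "A \<subseteq> P - {w}" "connected (Y - A)"
  using assms unfolding ramified_def by (elim exE conjE) (rule that)

text \<open>The sets \<open>U\<close> and \<open>V\<close> below are open and disjoint. They cover \<open>NC_star X\<close> because a member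
  contained in \<open>P\<close> that meets \<open>Q \<union> R\<close> would contain \<open>w\<close>, and removing \<open>w\<close> separates the rest of
  \<open>R\<close> from the rest of \<open>Q\<close>.\<close>

lemma ramified_imp_NC_star_not_connected:
  assumes X: "compact X" "connected X" and ram: "ramified X"
  shows "\<not> connected_space (subtopology (hyperspace X) (NC_star X))"
proof -
  obtain w P Q R A where
    XU: "X = P \<union> Q \<union> R" and cl: "closed P" "closed Q" "closed R"
    and int: "P \<inter> Q = {w}" "P \<inter> R = {w}" "Q \<inter> R = {w}" and ne: "Q \<noteq> {w}" "R \<noteq> {w}"
    and A: "closed A" "connected A" "A \<noteq> {}" "A \<subseteq> P - {w}" "connected (X - A)"
    using ram by (rule ramifiedE)
  have w: "w \<in> P" "w \<in> Q" "w \<in> R" and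
    int': "\<And>x. x \<in> P \<Longrightarrow> x \<in> Q \<Longrightarrow> x = w" "\<And>x. x \<in> P \<Longrightarrow> x \<in> R \<Longrightarrow> x = w"
      "\<And>x. x \<in> Q \<Longrightarrow> x \<in> R \<Longrightarrow> x = w"
    using int by auto
  obtain q r where qr: "q \<in> Q" "q \<noteq> w" "r \<in> R" "r \<noteq> w"
    using ne w by blast
  define U where "U = {B \<in> subcontinua X. B \<inter> (Q \<union> R) = {}}"
  define V where "V = {B \<in> subcontinua X. \<not> B \<subseteq> P}"
  have opn: "openin (hyperspace X) U" "openin (hyperspace X) V"
    using openin_hyperspace_disjoint_closed[of X "Q \<union> R"]
      openin_hyperspace_not_subset_closed[of X P] X cl qr by (auto simp: U_def V_def)
  have "A \<in> subcontinua X"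
    using A XU by (intro subcontinuaI) auto
  then have 1: "A \<in> U" "A \<in> NC_star X"
    using A int' by (auto simp: NC_star_def U_def V_def)
  have "X \<in> subcontinua X"
    using X A XU by (intro subcontinuaI) (auto simp: compact_imp_closed)
  then have 2: "X \<in> V" "X \<in> NC_star X"
    using XU qr int' by (auto simp: NC_star_def U_def V_def)
  have cover: "NC_star X \<subseteq> U \<union> V"
  proof
    fix B assume B: "B \<in> NC_star X"
    have "B \<inter> (Q \<union> R) = {}" if BP: "B \<subseteq> P"
    proof (rule ccontr)
      assume "B \<inter> (Q \<union> R) \<noteq> {}"
      then obtain x where x: "x \<in> B" "x \<in> Q \<or> x \<in> R"
        by blast
      then have "x = w"
        using int'(1,2)[of x] BP by auto
      with x have wB: "w \<in> B"
        by simp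
      have "connected (X - B)"
        using B by (simp add: NC_star_def)
      moreover have "X - B \<subseteq> (P \<union> Q) \<union> R"
        using XU by blast
      moreover have "(P \<union> Q) \<inter> R \<inter> (X - B) = {}"
        using int' wB by blast
      moreover have "q \<in> (P \<union> Q) \<inter> (X - B)" "r \<in> R \<inter> (X - B)"
        using XU qr int' BP by blast+
      moreover have "closed (P \<union> Q)"
        using cl by blast
      ultimately show False
        using connected_closedD[of "X - B" "P \<union> Q" R] cl(3) by auto
    qed
    then show "B \<in> U \<union> V"
      using B by (auto simp: NC_star_def U_def V_def)
  qed
  have disj: "U \<inter> V = {}"
    using XU subcontinua_compact(4)[OF X(1)] by (auto simp: U_def V_def)
  have "\<not> connectedin (hyperspace X) (NC_star X)"
    using opn cover disj 1 2 unfolding connectedin by blast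
  moreover have "NC_star X \<subseteq> topspace (hyperspace X)"
    using X(1) by (auto simp: topspace_hyperspace NC_star_def)
  ultimately show ?thesis
    unfolding connectedin_def by blast
qed

text \<open>The new piece is added to whichever of \<open>P\<close>, \<open>Q\<close>, \<open>R\<close> contains the point of attachment. If
  this point lies in \<open>A\<close>, the piece is added to \<open>A\<close> as well, so that the complement of \<open>A\<close> stays
  the same; otherwise the piece enlarges the complement of \<open>A\<close> and is connected to it.\<close>

lemma ramified_attach:
  assumes ram: "ramified Y" and T: "closed T" "connected T" and p: "Y \<inter> T = {p}"
  shows "ramified (Y \<union> T)"
proof -
  obtain w P Q R A where
    YU: "Y = P \<union> Q \<union> R" and cl: "closed P" "closed Q" "closed R"
    and int: "P \<inter> Q = {w}" "P \<inter> R = {w}" "Q \<inter> R = {w}" and ne: "Q \<noteq> {w}" "R \<noteq> {w}"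
    and A: "closed A" "connected A" "A \<noteq> {}" "A \<subseteq> P - {w}" "connected (Y - A)"
    using ram by (rule ramifiedE)
  have w: "w \<in> P" "w \<in> Q" "w \<in> R" and
    int': "\<And>x. x \<in> P \<Longrightarrow> x \<in> Q \<Longrightarrow> x = w" "\<And>x. x \<in> P \<Longrightarrow> x \<in> R \<Longrightarrow> x = w"
      "\<And>x. x \<in> Q \<Longrightarrow> x \<in> R \<Longrightarrow> x = w"
    using int by auto
  have p': "p \<in> Y" "p \<in> T" "\<And>x. x \<in> Y \<Longrightarrow> x \<in> T \<Longrightarrow> x = p"
    using p by auto
  show ?thesis
  proof (cases "p \<in> A")
    case True
    have con: "connected ((Y \<union> T) - (A \<union> T))"
    proof -
      have "(Y \<union> T) - (A \<union> T) = Y - A"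
        using p' True by blast
      then show ?thesis
        using A(5) by simp
    qed
    have AT: "connected (A \<union> T)"
      using True p' A(2) T(2) by (intro connected_Un) blast+
    have "(P \<union> T) \<inter> Q = {w}" "(P \<union> T) \<inter> R = {w}" "A \<union> T \<subseteq> (P \<union> T) - {w}"
      "Y \<union> T = (P \<union> T) \<union> Q \<union> R" "A \<union> T \<noteq> {}"
      using p' True A(4) w int' YU by blast+
    then show ?thesis
      using cl int ne A(1) T con AT
      by (intro ramifiedI[of _ "P \<union> T" Q R w "A \<union> T"]) (simp_all add: closed_Un)
  next
    case False
    have con: "connected (Y \<union> T - A)"
    proof -
      have "Y \<union> T - A = (Y - A) \<union> T"
        using p' False A(4) YU by blast
      moreover have "(Y - A) \<inter> T \<noteq> {}"
        using p'(1,2) False by blast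
      ultimately show ?thesis
        using connected_Un[OF A(5) T(2)] by simp
    qed
    consider "p \<in> P" | "p \<in> Q" | "p \<in> R"
      using p'(1) YU by blast
    then show ?thesis
    proof cases
      case 1
      have "Y \<union> T = (P \<union> T) \<union> Q \<union> R" "(P \<union> T) \<inter> Q = {w}" "(P \<union> T) \<inter> R = {w}"
        "A \<subseteq> (P \<union> T) - {w}"
        using p' 1 A(4) w int' YU by blast+
      then show ?thesis
        using cl int ne A T con
        by (intro ramifiedI[of _ "P \<union> T" Q R w A]) (simp_all add: closed_Un)
    next
      case 2
      have "Y \<union> T = P \<union> (Q \<union> T) \<union> R" "P \<inter> (Q \<union> T) = {w}" "(Q \<union> T) \<inter> R = {w}" "Q \<union> T \<noteq> {w}"
        using p' 2 w int' YU ne by blast+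
      then show ?thesis
        using cl int ne A T con
        by (intro ramifiedI[of _ P "Q \<union> T" R w A]) (simp_all add: closed_Un)
    next
      case 3
      have "Y \<union> T = P \<union> Q \<union> (R \<union> T)" "P \<inter> (R \<union> T) = {w}" "Q \<inter> (R \<union> T) = {w}" "R \<union> T \<noteq> {w}"
        using p' 3 w int' YU ne by blast+
      then show ?thesis
        using cl int ne A T con
        by (intro ramifiedI[of _ P Q "R \<union> T" w A]) (simp_all add: closed_Un)
    qed
  qed
qed

section \<open>Attaching an arc at one end point\<close>

lemma arc_image_interval:
  assumes "arc (h :: real \<Rightarrow> 'a::t2_space)" "0 \<le> a" "b \<le> 1"
  shows "compact (h ` {a..b})" "closed (h ` {a..b})" "connected (h ` {a..b})"
proof -
  have "continuous_on {a..b} h"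
    using assms by (auto simp: arc_def path_def intro: continuous_on_subset)
  then show "compact (h ` {a..b})" "connected (h ` {a..b})"
    by (auto intro: compact_continuous_image connected_continuous_image)
  then show "closed (h ` {a..b})"
    by (simp add: compact_imp_closed)
qed

text \<open>Attaching at an interior point \<open>h t\<close> of an arc creates a branch point. The branches are the
  new arc and the two halves of the old one, and the free end of the new arc serves as \<open>A\<close>.\<close>

lemma ramified_attach_interior:
  fixes h g :: "real \<Rightarrow> 'a::t2_space"
  assumes h: "arc h" and g: "arc g" and t: "0 < t" "t < 1" "h t = pathstart g"
    and int: "path_image h \<inter> path_image g = {pathstart g}"
  shows "ramified (path_image h \<union> path_image g)"
proof -
  let ?P = "path_image g" and ?Q = "h ` {0..t}" and ?R = "h ` {t..1}"
  have int': "pathstart g \<in> path_image h"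
    "\<And>x. x \<in> path_image h \<Longrightarrow> x \<in> path_image g \<Longrightarrow> x = pathstart g"
    using int by auto
  have ih: "inj_on h {0..1}" and ig: "inj_on g {0..1}"
    using h g by (auto simp: arc_def)
  have split: "{0..1} = {0..t} \<union> {t..1}" "{0..t} \<inter> {t..1} = {t}"
    using t by auto
  have hU: "path_image h = ?Q \<union> ?R"
    using split(1) by (simp add: path_image_def image_Un[symmetric])
  have QR: "?Q \<inter> ?R = {h t}"
    using inj_on_image_Int[OF ih, of "{0..t}" "{t..1}"] split(2) t by auto
  have ends: "h 0 \<noteq> h t" "h 1 \<noteq> h t"
    using inj_onD[OF ih, of 0 t] inj_onD[OF ih, of 1 t] t by auto
  have "?P - {pathfinish g} = g ` ({0..1} - {1})"
    using ig by (auto simp: path_image_def pathfinish_def inj_on_def)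
  moreover have "{0..1} - {1} = {0..<1::real}"
    by auto
  moreover have "continuous_on {0..<1} g"
    using g by (auto simp: arc_def path_def intro: continuous_on_subset)
  ultimately have con: "connected (?P - {pathfinish g})"
    by (simp add: connected_continuous_image)
  have fin: "pathfinish g \<noteq> pathstart g" "pathfinish g \<in> ?P" "pathstart g \<in> ?P"
    using arc_distinct_ends[OF g] by auto
  have "path_image h \<union> ?P - {pathfinish g} = path_image h \<union> (?P - {pathfinish g})"
    using int'(2)[OF _ fin(2)] fin(1) by auto
  moreover have "connected (path_image h \<union> (?P - {pathfinish g}))"
  proof (rule connected_Un)
    show "connected (path_image h)"
      by (rule connected_arc_image[OF h])
    have "pathstart g \<in> path_image h \<inter> (?P - {pathfinish g})"
      using int'(1) fin by simp
    then show "path_image h \<inter> (?P - {pathfinish g}) \<noteq> {}"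
      by blast
  qed (rule con)
  ultimately have con': "connected (path_image h \<union> ?P - {pathfinish g})"
    by simp
  have PQ: "?P \<inter> ?Q = {h t}" and PR: "?P \<inter> ?R = {h t}"
    using int'(2) hU t QR fin(3) by auto
  have "?Q \<noteq> {h t}" "?R \<noteq> {h t}"
    using ends t by (metis atLeastAtMost_iff image_eqI less_imp_le order_refl singletonD)+
  moreover have "path_image h \<union> ?P = ?P \<union> ?Q \<union> ?R"
    using hU by blast
  ultimately show ?thesis
    using PQ PR QR con' fin t arc_image_interval[OF h] closed_arc_image[OF g]
    by (intro ramifiedI[of _ ?P ?Q ?R "h t" "{pathfinish g}"]) simp_all
qed

definition arc_or_ramified :: "'a::topological_space set \<Rightarrow> bool" where
  "arc_or_ramified Y \<longleftrightarrow> (\<exists>h. arc h \<and> Y = path_image h) \<or> ramified Y"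

lemma arc_or_ramified_attach:
  fixes g :: "real \<Rightarrow> 'a::t2_space"
  assumes Y: "arc_or_ramified Y" and g: "arc g" and int: "Y \<inter> path_image g = {pathstart g}"
  shows "arc_or_ramified (Y \<union> path_image g)"
proof -
  consider h where "arc h" "Y = path_image h" | "ramified Y"
    using Y by (auto simp: arc_or_ramified_def)
  then show ?thesis
  proof cases
    case 1
    have "pathstart g \<in> path_image h"
      using int 1 by blast
    then obtain t where t: "0 \<le> t" "t \<le> 1" "h t = pathstart g"
      by (auto simp: path_image_def)
    consider "t = 0" | "t = 1" | "0 < t" "t < 1"
      using t by linarith
    then show ?thesis
    proof cases
      case a: 1
      have "arc (reversepath h +++ g)"
        using 1 g t a int by (intro arc_join) (simp_all add: arc_reversepath, simp_all add: pathstart_def)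
      moreover have "path_image (reversepath h +++ g) = Y \<union> path_image g"
        using 1 t a by (subst path_image_join) (auto simp: pathstart_def)
      ultimately show ?thesis
        unfolding arc_or_ramified_def by metis
    next
      case a: 2
      have "arc (h +++ g)"
        using 1 g t a int by (intro arc_join) (simp_all add: pathfinish_def)
      moreover have "path_image (h +++ g) = Y \<union> path_image g"
        using 1 t a by (subst path_image_join) (auto simp: pathfinish_def)
      ultimately show ?thesis
        unfolding arc_or_ramified_def by metis
    next
      case 3
      then show ?thesis
        using ramified_attach_interior[OF 1(1) g 3 t(3)] int 1(2) by (simp add: arc_or_ramified_def)
    qed
  next
    case 2
    then have "ramified (Y \<union> path_image g)"
      using ramified_attach[of Y "path_image g"] int g
      by (simp add: closed_arc_image connected_arc_image)
    then show ?thesis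
      by (simp add: arc_or_ramified_def)
  qed
qed

section \<open>Arcwise connectedness\<close>

definition arcwise_connected :: "'a::topological_space set \<Rightarrow> bool" where
  "arcwise_connected Y \<longleftrightarrow> (\<forall>x\<in>Y. \<forall>y\<in>Y. x \<noteq> y \<longrightarrow>
     (\<exists>g. arc g \<and> path_image g \<subseteq> Y \<and> pathstart g = x \<and> pathfinish g = y))"

text \<open>The subarc is \<open>g\<close> composed with the affine map \<open>l\<close> from the unit interval onto the interval
  between the parameters of the two points, run backwards if these come in the opposite order.\<close>

lemma arcwise_connected_arc_image:
  assumes g: "arc (g :: real \<Rightarrow> 'a::topological_space)"
  shows "arcwise_connected (path_image g)"
  unfolding arcwise_connected_def
proof (intro ballI impI)
  fix x y assume xy: "x \<in> path_image g" "y \<in> path_image g" "x \<noteq> y"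
  obtain u v where uv: "u \<in> {0..1}" "v \<in> {0..1}" "x = g u" "y = g v"
    using xy by (auto simp: path_image_def)
  define l where "l t = (1 - t) * u + t * v" for t
  have l: "l ` {0..1} \<subseteq> {0..1}"
    using uv convex_bound_le[of u 1 v] by (auto simp: l_def)
  have "continuous_on {0..1} l"
    unfolding l_def by (intro continuous_intros)
  then have "continuous_on {0..1} (g \<circ> l)"
    using g l by (intro continuous_on_compose) (auto simp: arc_def path_def intro: continuous_on_subset)
  moreover have "inj_on l {0..1}"
  proof (rule inj_onI)
    fix s t assume "l s = l t"
    then have "(s - t) * (v - u) = 0"
      by (simp add: l_def algebra_simps)
    then show "s = t"
      using uv xy by auto
  qed
  then have "inj_on (g \<circ> l) {0..1}"
    using g l by (auto simp: arc_def intro!: comp_inj_on intro: inj_on_subset)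
  ultimately have "arc (g \<circ> l)"
    by (simp add: arc_def path_def)
  moreover have "path_image (g \<circ> l) \<subseteq> path_image g"
    using l by (auto simp: path_image_def)
  ultimately show "\<exists>k. arc k \<and> path_image k \<subseteq> path_image g \<and> pathstart k = x \<and> pathfinish k = y"
    using uv by (intro exI[of _ "g \<circ> l"]) (simp add: pathstart_def pathfinish_def l_def)
qed

lemma arcwise_connected_Un:
  fixes S T :: "'a::topological_space set"
  assumes S: "arcwise_connected S" and T: "arcwise_connected T" and p: "S \<inter> T = {p}"
  shows "arcwise_connected (S \<union> T)"
proof -
  have mixed: "\<exists>g. arc g \<and> path_image g \<subseteq> S \<union> T \<and> pathstart g = x \<and> pathfinish g = y"
    if xy: "x \<in> S" "y \<in> T" "x \<noteq> y" for x y
  proof (cases "x = p \<or> y = p")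
    case True
    then have "(x \<in> T \<and> y \<in> T) \<or> (x \<in> S \<and> y \<in> S)"
      using xy p by blast
    then show ?thesis
      using S T xy(3) unfolding arcwise_connected_def by (meson le_supI1 le_supI2)
  next
    case False
    obtain a where a: "arc a" "path_image a \<subseteq> S" "pathstart a = x" "pathfinish a = p"
      using S xy p False unfolding arcwise_connected_def by blast
    obtain b where b: "arc b" "path_image b \<subseteq> T" "pathstart b = p" "pathfinish b = y"
      using T xy p False unfolding arcwise_connected_def by (metis IntD2 insertI1)
    have "arc (a +++ b)"
      using a b p by (intro arc_join) auto
    moreover have "path_image (a +++ b) \<subseteq> S \<union> T"
      using a b by (subst path_image_join) auto
    ultimately show ?thesis
      using a b by (intro exI[of _ "a +++ b"]) simp
  qed
  have rev: "\<exists>g. arc g \<and> path_image g \<subseteq> S \<union> T \<and> pathstart g = y \<and> pathfinish g = x"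
    if xy: "x \<in> S" "y \<in> T" "x \<noteq> y" for x y
    using mixed[OF xy] by (metis arc_reversepath path_image_reversepath pathfinish_reversepath pathstart_reversepath)
  show ?thesis
    unfolding arcwise_connected_def
  proof (intro ballI impI)
    fix x y assume xy: "x \<in> S \<union> T" "y \<in> S \<union> T" "x \<noteq> y"
    consider "x \<in> S" "y \<in> S" | "x \<in> T" "y \<in> T" | "x \<in> S" "y \<in> T" | "x \<in> T" "y \<in> S"
      using xy by blast
    then show "\<exists>g. arc g \<and> path_image g \<subseteq> S \<union> T \<and> pathstart g = x \<and> pathfinish g = y"
    proof cases
      case 1
      then show ?thesis
        using S xy(3) unfolding arcwise_connected_def by (meson le_supI1)
    next
      case 2
      then show ?thesis
        using T xy(3) unfolding arcwise_connected_def by (meson le_supI2)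
    next
      case 3
      then show ?thesis
        using mixed xy(3) by blast
    next
      case 4
      then show ?thesis
        using rev xy(3) by blast
    qed
  qed
qed

section \<open>Trees\<close>

text \<open>An arc through \<open>Y\<close> between the end points of \<open>g\<close> completes \<open>g\<close> to a simple loop.\<close>

lemma simple_closed_curve_arc_Un:
  fixes g :: "real \<Rightarrow> 'a::metric_space"
  assumes Y: "arcwise_connected Y" and g: "arc g"
    and int: "Y \<inter> path_image g = {pathstart g, pathfinish g}"
  shows "\<exists>S \<subseteq> Y \<union> path_image g. simple_closed_curve S"
proof -
  have "pathstart g \<noteq> pathfinish g"
    using arc_distinct_ends[OF g] by simp
  then obtain c where c: "arc c" "path_image c \<subseteq> Y" "pathstart c = pathfinish g" "pathfinish c = pathstart g"
    using Y int unfolding arcwise_connected_def by (metis Int_iff insertI1 insertI2)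
  have "simple_path (g +++ c)"
    using c g int by (intro simple_path_join_loop) auto
  then have "path_image (g +++ c) homeomorphic sphere (0::complex) 1"
    using c by (intro homeomorphic_simple_path_image_circle) auto
  moreover have "path_image (g +++ c) \<subseteq> Y \<union> path_image g"
    using c by (subst path_image_join) auto
  ultimately show ?thesis
    by (auto simp: simple_closed_curve_def)
qed

text \<open>Arcwise connectedness is carried along in the construction of the tree, as it is what turns a
  second point of contact into a simple closed curve. The construction is phrased by taking a maximal
  family \<open>H\<close> of edges whose union has the desired properties.\<close>

lemma tree_arc_or_ramified:
  fixes X :: "'a::metric_space set"
  assumes "tree X"
  shows "arc_or_ramified X"
proof -
  have X: "connected X" "X \<noteq> {}" and no_circle: "\<not> (\<exists>S\<subseteq>X. simple_closed_curve S)"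
    using assms by (auto simp: tree_def finite_graph_def continuum_def)
  obtain G where G: "finite G" "\<And>g. g \<in> G \<Longrightarrow> arc g" "X = (\<Union>g\<in>G. path_image g)"
    and ends: "\<And>g h. g \<in> G \<Longrightarrow> h \<in> G \<Longrightarrow> g \<noteq> h \<Longrightarrow>
        path_image g \<inter> path_image h \<subseteq> {pathstart g, pathfinish g}"
    using assms unfolding tree_def finite_graph_def by (metis Int_subset_iff)
  define good where "good H \<longleftrightarrow> H \<noteq> {} \<and> arcwise_connected (\<Union>g\<in>H. path_image g)
      \<and> arc_or_ramified (\<Union>g\<in>H. path_image g)" for H :: "(real \<Rightarrow> 'a) set"
  obtain g0 where g0: "g0 \<in> G"
    using X G by blast
  have "good {g0}"
    using G(2)[OF g0] arcwise_connected_arc_image by (auto simp: good_def arc_or_ramified_def)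
  then have "{H \<in> Pow G. good H} \<noteq> {}" "finite {H \<in> Pow G. good H}"
    using G(1) g0 by auto
  then obtain H where H: "H \<subseteq> G" "good H"
    and max: "\<And>H'. H' \<subseteq> G \<Longrightarrow> good H' \<Longrightarrow> H \<subseteq> H' \<Longrightarrow> H = H'"
    using finite_has_maximal[of "{H \<in> Pow G. good H}"] by auto
  let ?Y = "\<Union>g\<in>H. path_image g"
  have "H = G"
  proof (rule ccontr)
    assume "H \<noteq> G"
    let ?Z = "\<Union>g\<in>G - H. path_image g"
    have fin: "finite H" "finite (G - H)"
      using G(1) H(1) finite_subset by auto
    have "closed ?Y" "closed ?Z"
      using fin G(2) H(1) by (auto intro!: closed_UN closed_arc_image)
    moreover have "X \<subseteq> ?Y \<union> ?Z"
      using G(3) by blast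
    moreover have "?Y \<inter> X \<noteq> {}" "?Z \<inter> X \<noteq> {}"
    proof -
      have "?Y \<noteq> {}" "?Z \<noteq> {}"
        using H \<open>H \<noteq> G\<close> by (auto simp: good_def)
      moreover have "?Y \<subseteq> X" "?Z \<subseteq> X"
        using H G(3) by auto
      ultimately show "?Y \<inter> X \<noteq> {}" "?Z \<inter> X \<noteq> {}"
        by blast+
    qed
    ultimately have "?Y \<inter> ?Z \<noteq> {}"
      using connected_closedD[OF X(1), of ?Y ?Z] by blast
    then obtain g where g: "g \<in> G" "g \<notin> H" "?Y \<inter> path_image g \<noteq> {}"
      by blast
    have ag: "arc g" "arc (reversepath g)"
      using G(2)[OF g(1)] by (auto simp: arc_reversepath)
    have YH: "arcwise_connected ?Y" "arc_or_ramified ?Y"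
      using H(2) by (auto simp: good_def)
    have sub: "?Y \<inter> path_image g \<subseteq> {pathstart g, pathfinish g}"
      using ends[OF g(1)] H(1) g(2) by blast
    have step: "\<not> (arc k \<and> path_image k = path_image g \<and> ?Y \<inter> path_image k = {pathstart k})" for k
    proof
      assume k: "arc k \<and> path_image k = path_image g \<and> ?Y \<inter> path_image k = {pathstart k}"
      have "arc_or_ramified (?Y \<union> path_image k)"
        using arc_or_ramified_attach[OF YH(2)] k by blast
      moreover have "arcwise_connected (?Y \<union> path_image k)"
        using arcwise_connected_Un[OF YH(1) arcwise_connected_arc_image] k by blast
      ultimately have "good (insert g H)"
        using k by (simp add: good_def Un_commute)
      then show False
        using max[of "insert g H"] g H(1) by blast
    qed
    have "?Y \<inter> path_image g \<noteq> {pathstart g}" "?Y \<inter> path_image g \<noteq> {pathfinish g}"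
      using step[of g] step[of "reversepath g"] ag by auto
    then have "?Y \<inter> path_image g = {pathstart g, pathfinish g}"
      using sub g(3) by blast
    then have "\<exists>S \<subseteq> ?Y \<union> path_image g. simple_closed_curve S"
      by (rule simple_closed_curve_arc_Un[OF YH(1) ag(1)])
    moreover have "?Y \<union> path_image g \<subseteq> X"
      using H(1) g(1) G(3) by blast
    ultimately show False
      using no_circle by (meson order_trans)
  qed
  then show ?thesis
    using H(2) G(3) by (simp add: good_def)
qed

section \<open>The hyperspace of an arc\<close>

lemma hausdorff_dist_image_le:
  fixes h :: "'b \<Rightarrow> 'a::metric_space"
  assumes "S \<noteq> {}" "T \<noteq> {}" "bounded (h ` S)" "bounded (h ` T)"
    and "\<And>s. s \<in> S \<Longrightarrow> \<exists>t\<in>T. dist (h s) (h t) \<le> e"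
    and "\<And>t. t \<in> T \<Longrightarrow> \<exists>s\<in>S. dist (h t) (h s) \<le> e"
  shows "hausdorff_dist (h ` S) (h ` T) \<le> e"
proof -
  have "infdist (h s) (h ` T) \<le> e" if "s \<in> S" for s
    using assms(5)[OF that] infdist_le2 by (metis imageI)
  moreover have "infdist (h t) (h ` S) \<le> e" if "t \<in> T" for t
    using assms(6)[OF that] infdist_le2 by (metis imageI)
  ultimately show ?thesis
    using assms by (subst hausdorff_dist_le_iff) auto
qed

text \<open>If the end points of two intervals are closer than \<open>d\<close>, then each point of one interval is
  closer than \<open>d\<close> to the other interval; uniform continuity of \<open>h\<close> carries this over to the images.\<close>

lemma continuous_map_arc_intervals:
  fixes h :: "real \<Rightarrow> 'a::metric_space"
  assumes h: "arc h" and L: "\<And>a b. (a, b) \<in> L \<Longrightarrow> 0 \<le> a \<and> a \<le> b \<and> b \<le> 1"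
  shows "continuous_map (top_of_set L) (hyperspace (path_image h)) (\<lambda>(a, b). h ` {a..b})"
proof -
  let ?X = "path_image h" and ?f = "\<lambda>(a, b). h ` {a..b}"
  have X: "compact ?X"
    using h by (simp add: compact_arc_image)
  interpret Metric_space "subcontinua ?X" hausdorff_dist
    using X by (rule Metric_space_subcontinua)
  have mem: "h ` {a..b} \<in> subcontinua ?X" if "(a, b) \<in> L" for a b
    using L[OF that] arc_image_interval[OF h, of a b]
    by (intro subcontinuaI) (auto simp: path_image_def)
  have uc: "uniformly_continuous_on {0..1} h"
    using h by (intro compact_uniformly_continuous) (auto simp: arc_def path_def)
  have "\<exists>U. openin (top_of_set L) U \<and> x \<in> U \<and> (\<forall>y\<in>U. ?f y \<in> mball (?f x) e)"
    if x: "x \<in> L" and e: "e > 0" for x and e :: real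
  proof -
    obtain d where d: "d > 0"
      "\<And>s t. s \<in> {0..1} \<Longrightarrow> t \<in> {0..1} \<Longrightarrow> dist s t < d \<Longrightarrow> dist (h s) (h t) < e / 2"
      using uc e unfolding uniformly_continuous_on_def by (metis dist_commute half_gt_zero)
    have near: "\<exists>t\<in>{a'..b'}. dist (h s) (h t) \<le> e / 2"
      if ab: "(a, b) \<in> L" "(a', b') \<in> L" "dist a a' < d" "dist b b' < d" and s: "s \<in> {a..b}"
      for a b a' b' s
    proof -
      \<comment> \<open>the point of \<open>{a'..b'}\<close> nearest to \<open>s\<close>\<close>
      define t where "t = max a' (min b' s)"
      have "t \<in> {a'..b'}" "dist s t < d" "t \<in> {0..1}" "s \<in> {0..1}"
        using L[OF ab(1)] L[OF ab(2)] ab(3,4) s d(1) by (auto simp: t_def dist_real_def)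
      then show ?thesis
        using d(2)[of s t] by (auto intro: less_imp_le)
    qed
    have "?f y \<in> mball (?f x) e" if y: "y \<in> L \<inter> ball x d" for y
    proof -
      obtain a b a' b' where ab: "x = (a, b)" "y = (a', b')"
        by fastforce
      have m: "(a, b) \<in> L" "(a', b') \<in> L"
        using x y ab by auto
      have "dist a a' < d" "dist b b' < d"
        using y dist_fst_le[of x y] dist_snd_le[of x y] ab by auto
      then have "hausdorff_dist (h ` {a..b}) (h ` {a'..b'}) \<le> e / 2"
        using near[OF m] near[OF m(2,1)] L[OF m(1)] L[OF m(2)] subcontinua_compact(5)[OF X mem] m
        by (intro hausdorff_dist_image_le) (auto simp: dist_commute)
      then show ?thesis
        using mem m e ab by (auto simp: in_mball)
    qed
    then show ?thesis
      using x d(1) by (intro exI[of _ "L \<inter> ball x d"]) auto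
  qed
  then show ?thesis
    unfolding hyperspace_def continuous_map_to_metric by simp
qed

text \<open>If \<open>a > 0\<close> and \<open>b < 1\<close>, both end points of the unit interval lie outside \<open>{a..b}\<close>, which then
  separates them.\<close>

lemma NC_star_arc:
  fixes h :: "real \<Rightarrow> 'a::metric_space"
  assumes h: "arc h"
  shows "NC_star (path_image h) = (\<lambda>(a, b). h ` {a..b}) ` ({0} \<times> {0..1} \<union> {0..1} \<times> {1})"
    (is "?N = ?f ` ?L")
proof
  let ?X = "path_image h"
  have inj: "inj_on h {0..1}" and cont: "continuous_on {0..1} h"
    using h by (auto simp: arc_def path_def)
  show "?N \<subseteq> ?f ` ?L"
  proof
    fix A assume A: "A \<in> ?N"
    have X: "compact ?X"
      using h by (simp add: compact_arc_image)
    have sub: "A \<in> subcontinua ?X"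
      using A by (simp add: NC_star_def)
    note sA = subcontinua_compact[OF X sub]
    obtain k where k: "homeomorphism {0..1} ?X h k"
      using homeomorphism_arc[OF h] by blast
    have ck: "continuous_on ?X k" and imk: "k ` ?X = {0..1}"
      and hk: "\<And>x. x \<in> ?X \<Longrightarrow> h (k x) = x"
      using k by (auto simp: homeomorphism_def)
    have "connected (k ` A) \<and> compact (k ` A)"
      using sA ck by (auto intro!: compact_continuous_image connected_continuous_image
          intro: continuous_on_subset)
    then obtain a b where ab: "k ` A = {a..b}"
      using connected_compact_interval_1 by metis
    have "{a..b} \<noteq> {}" "{a..b} \<subseteq> {0..1}"
      using ab sA imk by (metis image_is_empty, metis image_mono)
    then have le: "0 \<le> a" "a \<le> b" "b \<le> 1"
      by auto
    have "A = h ` k ` A"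
      using hk sA(4) by force
    then have Aab: "A = h ` {a..b}"
      using ab by simp
    have "k ` (?X - A) = {0..1} - {a..b}"
      using inj_on_image_set_diff[of k ?X ?X A] imk ab sA(4) hk by (metis Diff_subset inj_onI)
    moreover have "connected (k ` (?X - A))"
      using A ck by (auto simp: NC_star_def intro!: connected_continuous_image
          intro: continuous_on_subset)
    ultimately have "connected ({0..1} - {a..b})"
      by simp
    then have "a = 0 \<or> b = 1"
      using connectedD_interval[of "{0..1} - {a..b}" 0 1 a] le by auto
    then show "A \<in> ?f ` ?L"
      using Aab le by (intro image_eqI[of _ _ "(a, b)"]) auto
  qed
  show "?f ` ?L \<subseteq> ?N"
  proof clarify
    fix a b :: real assume ab: "(a, b) \<in> ?L"
    have "h ` {a..b} \<in> subcontinua ?X"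
      using ab arc_image_interval[OF h, of a b]
      by (intro subcontinuaI) (auto simp: path_image_def)
    moreover have "?X - h ` {a..b} = h ` ({0..1} - {a..b})"
      using ab inj by (subst inj_on_image_set_diff[OF inj]) (auto simp: path_image_def)
    moreover have "{0..1} - {a..b} = (if a = 0 then {b<..1} else {0..<a})"
      using ab by auto
    then have "connected ({0..1} - {a..b})"
      by simp
    then have "connected (h ` ({0..1} - {a..b}))"
      using cont by (intro connected_continuous_image) (auto intro: continuous_on_subset)
    ultimately show "h ` {a..b} \<in> ?N"
      by (simp add: NC_star_def)
  qed
qed

lemma connected_NC_star_arc:
  fixes h :: "real \<Rightarrow> 'a::metric_space"
  assumes h: "arc h"
  shows "connected_space (subtopology (hyperspace (path_image h)) (NC_star (path_image h)))"
proof -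
  let ?L = "{0} \<times> {0..1} \<union> {0..1} \<times> {1::real} :: (real \<times> real) set"
  have "connected ?L"
  proof (rule connected_Un)
    show "connected ({0} \<times> {0..1::real} :: (real \<times> real) set)"
      by (rule connected_Times) simp_all
    show "connected ({0..1} \<times> {1::real} :: (real \<times> real) set)"
      by (rule connected_Times) simp_all
    have "(0, 1) \<in> {0} \<times> {0..1} \<inter> {0..1::real} \<times> {1::real}"
      by simp
    then show "{0} \<times> {0..1} \<inter> {0..1} \<times> {1} \<noteq> ({} :: (real \<times> real) set)"
      by blast
  qed
  then have L: "connectedin (top_of_set ?L) ?L"
    by (simp only: connectedin_subtopology connectedin_iff_connected order_refl)
  have "continuous_map (top_of_set ?L) (hyperspace (path_image h)) (\<lambda>(a, b). h ` {a..b})"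
    by (rule continuous_map_arc_intervals[OF h]) auto
  from connectedin_continuous_map_image[OF this L]
  have "connectedin (hyperspace (path_image h)) (NC_star (path_image h))"
    unfolding NC_star_arc[OF h] .
  then show ?thesis
    unfolding connectedin_def by blast
qed

theorem corollary3p7:
  fixes X :: "'a::metric_space set"
  assumes "tree X"
  shows "connected_space (subtopology (hyperspace X) (NC_star X))
     \<longleftrightarrow> X homeomorphic {0..1::real}"
proof
  assume con: "connected_space (subtopology (hyperspace X) (NC_star X))"
  have "compact X" "connected X"
    using assms by (auto simp: tree_def finite_graph_def continuum_def)
  then have "\<not> ramified X"
    using con ramified_imp_NC_star_not_connected by blast
  then obtain h where "arc h" "X = path_image h"
    using tree_arc_or_ramified[OF assms] by (auto simp: arc_or_ramified_def)
  then show "X homeomorphic {0..1::real}"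
    by (simp add: homeomorphic_arc_image_interval)
next
  assume "X homeomorphic {0..1::real}"
  then have "{0..1::real} homeomorphic X"
    by (rule iffD1[OF homeomorphic_sym])
  then obtain h k where "homeomorphism {0..1::real} X h k"
    unfolding homeomorphic_def by blast
  then have "arc h" "X = path_image h"
    by (auto simp: homeomorphism_def arc_def path_def path_image_def intro: inj_on_inverseI)
  then show "connected_space (subtopology (hyperspace X) (NC_star X))"
    using connected_NC_star_arc by blast
qed

end
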